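(* For every finite simple graph $G$ there exist infinitely many finite non-empty sets $S$ of primes such that $G$ is representable with $S$.
   Context: All graphs are simple and have at least one vertex. For a finite non-empty set $S$ of primes, $\mathbb{Z}_S$ is the ring of those rationals whose denominators (in lowest terms) are not divisible by primes outside $S$, and $\mathbb{Z}_S^*$ is its multiplicative group of invertible elements ($S$-units). For a subset $A$ of $\mathbb{Z}_S$, $\mathcal{G}_S(A)$ is the graph with vertex set $A$ in which two vertices $a,b\in A$ are joined by an edge if and only if $a-b\in\mathbb{Z}_S^*$. A finite graph $G$ is representable with $S$ if there is a finite subset $A$ of $\mathbb{Z}_S$ such that $\mathcal{G}_S(A)$ is isomorphic to $G$. *)

theory Defs
  imports
    "HOL-Computational_Algebra.Primes"
    "Graph_Theory.Pair_Digraph"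
    "Graph_Theory.Digraph_Isomorphism"
begin

definition S_integers :: "nat set \<Rightarrow> rat set" where
  "S_integers S = {x. \<forall>p. prime p \<and> int p dvd snd (quotient_of x) \<longrightarrow> p \<in> S}"

definition S_units :: "nat set \<Rightarrow> rat set" where
  "S_units S = {u \<in> S_integers S. \<exists>v \<in> S_integers S. u * v = 1}"

text \<open>An undirected edge is represented, as in \<^locale>\<open>pair_graph\<close>, by the two opposite arcs
  between its end points.\<close>

definition S_unit_graph :: "nat set \<Rightarrow> rat set \<Rightarrow> rat pair_pre_digraph" where
  "S_unit_graph S A = \<lparr>pverts = A, parcs = {(a, b). a \<in> A \<and> b \<in> A \<and> a - b \<in> S_units S}\<rparr>"

lemma S_integers_uminus: "x \<in> S_integers S \<Longrightarrow> - x \<in> S_integers S"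
  by (simp add: S_integers_def rat_uminus_code split: prod.splits)

lemma S_units_uminus: "x \<in> S_units S \<Longrightarrow> - x \<in> S_units S"
  unfolding S_units_def by (auto simp: S_integers_uminus intro!: bexI[of _ "- v" for v])

lemma pair_graph_S_unit_graph:
  assumes "finite A"
  shows "pair_graph (S_unit_graph S A)"
proof
  show "finite (parcs (S_unit_graph S A))"
    by (rule finite_subset[of _ "A \<times> A"]) (auto simp: S_unit_graph_def assms)
  show "symmetric (with_proj (S_unit_graph S A))"
    unfolding symmetric_def
    by (auto simp: S_unit_graph_def sym_def dest: S_units_uminus)
qed (auto simp: S_unit_graph_def S_units_def assms)

definition representable :: "nat set \<Rightarrow> 'a pair_pre_digraph \<Rightarrow> bool" where
  "representable S G \<longleftrightarrow>
    (\<exists>A. finite A \<and> A \<subseteq> S_integers S \<and>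
      digraph_iso (with_proj (S_unit_graph S A)) (with_proj G))"

end

theory Submission
  imports Defs "HOL-Number_Theory.Cong"
begin

text \<open>
  Label the vertices \<open>v\<close> by distinct natural numbers \<open>a v\<close>. If every prime that divides a
  difference along an edge lies in \<open>S\<close>, then edges become \<open>S\<close>-unit differences, and a non-edge
  \<open>u v\<close> stays a non-edge as soon as one prime outside \<open>S\<close> divides \<open>a u - a v\<close>. So it
  is enough that for each non-edge some prime divides its difference but no difference along an
  edge. Such labels exist by the Chinese remainder theorem: modulo a prime larger than the number of
  vertices there is room to give \<open>u\<close> and \<open>v\<close> the same residue and to keep all other vertices
  apart, and for distinct primes these requirements are independent (lemma
  \<open>labelling_detecting_nonedges\<close>).

  With such labels and the finite set \<open>Q\<close> of primes attached to the non-edges, every set \<open>S\<close> of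
  primes is suitable that is disjoint from \<open>Q\<close> and contains the finitely many primes outside \<open>Q\<close>
  that can divide a difference of labels (lemma \<open>representable_by_labelling\<close>). One arbitrary
  further prime outside \<open>Q\<close> may be added to \<open>S\<close>, hence infinitely many \<open>S\<close> are suitable.
\<close>

lemma of_int_in_S_integers: "of_int z \<in> S_integers S"
  by (auto simp: S_integers_def not_prime_unit)

lemma of_int_in_S_units_iff:
  "of_int z \<in> S_units S \<longleftrightarrow> z \<noteq> 0 \<and> (\<forall>p. prime p \<longrightarrow> int p dvd z \<longrightarrow> p \<in> S)"
proof (cases "z = 0")
  case True
  then show ?thesis by (simp add: S_units_def)
next
  case False
  have "of_int z * v = 1 \<longleftrightarrow> v = inverse (of_int z)" for v :: rat
    using False by (auto simp: field_simps)
  then have "of_int z \<in> S_units S \<longleftrightarrow> inverse (of_int z) \<in> S_integers S"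
    by (auto simp: S_units_def of_int_in_S_integers)
  then show ?thesis
    using False by (simp add: S_integers_def rat_inverse_code imp_conjL)
qed

text \<open>
  The diagonal pairs \<open>(u, u)\<close> count as non-edges. The prime attached to such a pair separates all
  vertices, and this is why the labels are distinct even if \<open>E\<close> is empty.
\<close>

lemma labelling_detecting_nonedges:
  fixes V :: "'a set" and E :: "'a rel"
  assumes "finite V" "sym E" "irrefl E"
  obtains a :: "'a \<Rightarrow> nat" and Q :: "nat set"
  where "finite Q" "\<And>q. q \<in> Q \<Longrightarrow> prime q" "inj_on a V"
    "\<And>u v. u \<in> V \<Longrightarrow> v \<in> V \<Longrightarrow> (u, v) \<in> E \<longleftrightarrow> (\<forall>q\<in>Q. \<not> [a u = a v] (mod q))"
proof -
  obtain f :: "'a \<Rightarrow> nat" and n where f: "f ` V = {i. i < n}" "inj_on f V"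
    using finite_imp_inj_to_nat_seg[OF \<open>finite V\<close>] by blast
  define I where "I = V \<times> V - E"
  have fin: "finite I" using \<open>finite V\<close> by (simp add: I_def)
  have "{p::nat. prime p} \<subseteq> {p. prime p \<and> n < p} \<union> {..n}" by auto
  then have "infinite {p. prime p \<and> n < p}"
    using primes_infinite finite_subset by blast
  then obtain Q where Q: "Q \<subseteq> {p. prime p \<and> n < p}" "finite Q" "card Q = card I"
    using infinite_arbitrarily_large by blast
  then obtain q where q: "bij_betw q I Q"
    using finite_same_card_bij[OF fin] by metis
  have qI: "prime (q i)" "n < q i" if "i \<in> I" for i
    using bij_betwE[OF q] Q(1) that by auto
  \<comment> \<open>modulo the prime of the pair \<open>(u, v)\<close>, the vertex \<open>u\<close> moves to the residue of \<open>v\<close>\<close>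
  define r where "r w i = f (if w = fst i then snd i else w)" for w i
  have "\<exists>x. \<forall>i\<in>I. [x = r w i] (mod q i)" for w
  proof (rule chinese_remainder_nat[OF fin], intro ballI impI)
    fix i j assume "i \<in> I" "j \<in> I" "i \<noteq> j"
    then show "coprime (q i) (q j)"
      using qI q by (metis bij_betw_inv_into_left primes_coprime)
  qed
  then obtain a where a: "\<And>w i. i \<in> I \<Longrightarrow> [a w = r w i] (mod q i)"
    by metis
  have cong_iff: "[a x = a y] (mod q i) \<longleftrightarrow> r x i = r y i"
    if "i \<in> I" "x \<in> V" "y \<in> V" for i x y
  proof -
    have "r w i < q i" if "w \<in> V" for w
      using f(1) qI(2)[OF \<open>i \<in> I\<close>] \<open>i \<in> I\<close> that by (auto simp: r_def I_def intro: less_trans)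
    then have "[r x i = r y i] (mod q i) \<longleftrightarrow> r x i = r y i"
      using that by (simp add: cong_def)
    then show ?thesis
      using a[OF that(1)] by (meson cong_sym cong_trans)
  qed
  have r_iff: "r x (u, v) = r y (u, v) \<longleftrightarrow> x = y \<or> (x, y) = (u, v) \<or> (x, y) = (v, u)"
    if "(u, v) \<in> I" "x \<in> V" "y \<in> V" for u v x y
    using that f(2) by (auto simp: r_def I_def inj_on_eq_iff)
  show ?thesis
  proof
    show "finite Q" by fact
    show "prime p" if "p \<in> Q" for p using Q(1) that by auto
    show "inj_on a V"
    proof (rule inj_onI)
      fix x y assume xy: "x \<in> V" "y \<in> V" "a x = a y"
      have "(x, x) \<in> I" using xy \<open>irrefl E\<close> by (auto simp: I_def irrefl_def)
      then show "x = y" using cong_iff[of "(x, x)" x y] r_iff[of x x x y] xy by auto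
    qed
    show "(x, y) \<in> E \<longleftrightarrow> (\<forall>p\<in>Q. \<not> [a x = a y] (mod p))" if xy: "x \<in> V" "y \<in> V" for x y
    proof
      assume E: "(x, y) \<in> E"
      then have "(y, x) \<in> E" "x \<noteq> y"
        using \<open>sym E\<close> \<open>irrefl E\<close> by (auto simp: sym_def irrefl_def)
      then have "\<not> [a x = a y] (mod q i)" if "i \<in> I" for i
        using cong_iff[OF that xy] r_iff[of "fst i" "snd i" x y] that xy E
        by (auto simp: I_def)
      then show "\<forall>p\<in>Q. \<not> [a x = a y] (mod p)"
        using q by (auto simp: bij_betw_def)
    next
      assume Q: "\<forall>p\<in>Q. \<not> [a x = a y] (mod p)"
      show "(x, y) \<in> E"
      proof (rule ccontr)
        assume "(x, y) \<notin> E"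
        then have I: "(x, y) \<in> I" using xy by (simp add: I_def)
        then have "[a x = a y] (mod q (x, y))"
          using cong_iff[OF I xy] r_iff[OF I xy] by simp
        then show False using Q bij_betwE[OF q] I by blast
      qed
    qed
  qed
qed

text \<open>
  Isomorphisms in the sense of \<^const>\<open>digraph_iso\<close> carry separate maps on vertices and on arcs;
  between graphs whose arcs are pairs the vertex map determines the arc map.
\<close>

lemma digraph_iso_with_projI:
  assumes "pair_wf_digraph H" "bij_betw g (pverts H) (pverts G)" "pair_wf_digraph G"
    and "\<And>x y. x \<in> pverts H \<Longrightarrow> y \<in> pverts H \<Longrightarrow> (x, y) \<in> parcs H \<longleftrightarrow> (g x, g y) \<in> parcs G"
  shows "digraph_iso (with_proj H) (with_proj G)"
proof -
  interpret H: pair_wf_digraph H by fact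
  interpret G: pair_wf_digraph G by fact
  define h where
    "h = \<lparr>iso_verts = g, iso_arcs = map_prod g g, iso_head = snd, iso_tail = fst\<rparr>"
  have inj: "inj_on g (pverts H)" and img: "g ` pverts H = pverts G"
    using assms(2) by (auto simp: bij_betw_def)
  have "parcs H \<subseteq> pverts H \<times> pverts H" using H.wellformed' by auto
  then have "inj_on (map_prod g g) (parcs H)"
    using map_prod_inj_on[OF inj inj] inj_on_subset by blast
  then have "H.digraph_isomorphism h"
    using inj H.wf_digraph_axioms by (simp add: H.digraph_isomorphism_def h_def)
  moreover have "map_prod g g ` parcs H = parcs G"
  proof
    show "map_prod g g ` parcs H \<subseteq> parcs G"
    proof
      fix e assume "e \<in> map_prod g g ` parcs H"
      then obtain x y where "(x, y) \<in> parcs H" "e = (g x, g y)" by auto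
      then show "e \<in> parcs G" using assms(4)[of x y] H.wellformed'[of x y] by blast
    qed
    show "parcs G \<subseteq> map_prod g g ` parcs H"
    proof
      fix e assume "e \<in> parcs G"
      moreover obtain x y where e: "e = (x, y)" by (cases e)
      ultimately obtain x' y' where "x' \<in> pverts H" "y' \<in> pverts H" "x = g x'" "y = g y'"
        using G.wellformed'[of x y] img by blast
      then show "e \<in> map_prod g g ` parcs H"
        using assms(4)[of x' y'] \<open>e \<in> parcs G\<close> e by force
    qed
  qed
  then have "with_proj G = app_iso h (with_proj H)"
    using img by (simp add: app_iso_def h_def with_proj_def)
  ultimately show ?thesis unfolding digraph_iso_def by blast
qed

text \<open>
  The difference of two labels is at most \<open>B\<close> in absolute value, so only primes up to \<open>B\<close> matter
  for it. Along an edge the difference is non-zero and all its prime divisors avoid \<open>Q\<close>, hence lie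
  in \<open>S\<close>; along a non-edge some prime in \<open>Q\<close>, hence outside \<open>S\<close>, divides it.
\<close>

lemma representable_by_labelling:
  fixes G :: "'a pair_pre_digraph" and a :: "'a \<Rightarrow> nat"
  assumes "pair_graph G" "inj_on a (pverts G)"
    and E: "\<And>u v. u \<in> pverts G \<Longrightarrow> v \<in> pverts G \<Longrightarrow>
      (u, v) \<in> parcs G \<longleftrightarrow> (\<forall>q\<in>Q. \<not> [a u = a v] (mod q))"
    and bound: "\<And>v. v \<in> pverts G \<Longrightarrow> a v \<le> B"
    and Q: "\<And>q. q \<in> Q \<Longrightarrow> prime q" "Q \<inter> S = {}"
    and S: "\<And>p. prime p \<Longrightarrow> p \<le> B \<Longrightarrow> p \<notin> Q \<Longrightarrow> p \<in> S"
  shows "representable S G"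
proof -
  interpret G: pair_graph G by fact
  define V where "V = pverts G"
  define c :: "'a \<Rightarrow> rat" where "c = (\<lambda>v. of_int (int (a v)))"
  have inj: "inj_on c V"
    using assms(2) by (auto simp: inj_on_def c_def V_def)
  have unit: "c u - c v \<in> S_units S \<longleftrightarrow> (u, v) \<in> parcs G" if uv: "u \<in> V" "v \<in> V" for u v
  proof -
    have dvd_iff: "int p dvd int (a u) - int (a v) \<longleftrightarrow> [a u = a v] (mod p)" for p
      by (metis cong_iff_dvd_diff cong_int_iff)
    have "c u - c v \<in> S_units S \<longleftrightarrow>
        a u \<noteq> a v \<and> (\<forall>p. prime p \<longrightarrow> [a u = a v] (mod p) \<longrightarrow> p \<in> S)"
      using of_int_in_S_units_iff[of "int (a u) - int (a v)" S] dvd_iff by (simp add: c_def)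
    also have "\<dots> \<longleftrightarrow> (\<forall>q\<in>Q. \<not> [a u = a v] (mod q))"
    proof
      assume "a u \<noteq> a v \<and> (\<forall>p. prime p \<longrightarrow> [a u = a v] (mod p) \<longrightarrow> p \<in> S)"
      then show "\<forall>q\<in>Q. \<not> [a u = a v] (mod q)" using Q by blast
    next
      assume *: "\<forall>q\<in>Q. \<not> [a u = a v] (mod q)"
      then have "(u, v) \<in> parcs G" using E uv by (simp add: V_def)
      then have "u \<noteq> v" using G.pair_no_loops by force
      then have ne: "a u \<noteq> a v" using assms(2) uv by (auto simp: inj_on_def V_def)
      have "p \<in> S" if p: "prime p" "[a u = a v] (mod p)" for p
      proof (rule S)
        show "p \<notin> Q" using * p by blast
        have "int p dvd int (a u) - int (a v)" using p dvd_iff by blast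
        then have "int p \<le> \<bar>int (a u) - int (a v)\<bar>"
          using ne dvd_imp_le_int[of "int (a u) - int (a v)" "int p"] by simp
        then show "p \<le> B" using bound[of u] bound[of v] uv by (auto simp: V_def)
      qed fact
      with ne show "a u \<noteq> a v \<and> (\<forall>p. prime p \<longrightarrow> [a u = a v] (mod p) \<longrightarrow> p \<in> S)" by blast
    qed
    also have "\<dots> \<longleftrightarrow> (u, v) \<in> parcs G" using E uv by (simp add: V_def)
    finally show ?thesis .
  qed
  have fin: "finite (c ` V)" using G.pair_finite_verts by (simp add: V_def)
  interpret H: pair_graph "S_unit_graph S (c ` V)"
    by (rule pair_graph_S_unit_graph[OF fin])
  have "digraph_iso (with_proj G) (with_proj (S_unit_graph S (c ` V)))"
  proof (rule digraph_iso_with_projI)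
    show "bij_betw c (pverts G) (pverts (S_unit_graph S (c ` V)))"
      using inj_on_imp_bij_betw[OF inj] by (simp add: S_unit_graph_def V_def)
    show "(x, y) \<in> parcs G \<longleftrightarrow> (c x, c y) \<in> parcs (S_unit_graph S (c ` V))"
      if "x \<in> pverts G" "y \<in> pverts G" for x y
      using that unit by (simp add: S_unit_graph_def V_def)
  qed unfold_locales
  then have "digraph_iso (with_proj (S_unit_graph S (c ` V))) (with_proj G)"
    by (rule digraph_iso_swap[OF G.wf_digraph_axioms])
  moreover have "c ` V \<subseteq> S_integers S"
    using of_int_in_S_integers by (auto simp: c_def simp del: of_int_of_nat_eq)
  ultimately show ?thesis unfolding representable_def using fin by blast
qed

theorem theorem2p1:
  fixes G :: "'a pair_pre_digraph"
  assumes "pair_graph G" and "pverts G \<noteq> {}"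
  shows "infinite {S :: nat set. finite S \<and> S \<noteq> {} \<and> (\<forall>p\<in>S. prime p) \<and> representable S G}"
    (is "infinite ?R")
proof -
  interpret G: pair_graph G by fact
  have "sym (parcs G)"
    using G.pair_sym_arcs unfolding symmetric_def with_proj_simps .
  moreover have "irrefl (parcs G)"
    using G.pair_no_loops by (fastforce simp: irrefl_def)
  ultimately obtain a :: "'a \<Rightarrow> nat" and Q :: "nat set"
    where a: "finite Q" "\<And>q. q \<in> Q \<Longrightarrow> prime q" "inj_on a (pverts G)"
    "\<And>u v. u \<in> pverts G \<Longrightarrow> v \<in> pverts G \<Longrightarrow>
      (u, v) \<in> parcs G \<longleftrightarrow> (\<forall>q\<in>Q. \<not> [a u = a v] (mod q))"
    using labelling_detecting_nonedges[OF G.pair_finite_verts] by metis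
  define B where "B = Max (a ` pverts G)"
  define P where "P = {p. prime p \<and> p \<le> B} - Q"
  define X where "X = {p. prime p} - (Q \<union> {..B})"
  \<comment> \<open>the primes in \<open>X\<close> exceed \<open>B\<close>, so they are not in \<open>P\<close> and different ones give different sets\<close>
  have "infinite X"
    unfolding X_def using primes_infinite a(1) by (intro Diff_infinite_finite) auto
  moreover have "inj_on (\<lambda>p. insert p P) X"
    by (rule inj_onI) (auto simp: X_def P_def)
  moreover have "(\<lambda>p. insert p P) ` X \<subseteq> ?R"
  proof (clarsimp, intro conjI ballI)
    fix p assume p: "p \<in> X"
    show "finite P" unfolding P_def by simp
    show "prime p" using p by (simp add: X_def)
    show "prime p'" if "p' \<in> P" for p' using that by (simp add: P_def)
    show "representable (insert p P) G"
    proof (rule representable_by_labelling[OF assms(1) a(3,4)])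
      show "a v \<le> B" if "v \<in> pverts G" for v
        using that G.pair_finite_verts by (simp add: B_def)
    qed (use a(2) p in \<open>auto simp: P_def X_def\<close>)
  qed
  ultimately show ?thesis using finite_imageD infinite_super by blast
qed

end
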